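(* Let $P$ be any finite set of prime numbers. Then there exists a function $f:\mathbb{N}\to\{-1,1\}$ which is $P$-multiplicative (i.e. $f(pn)=f(p)f(n)$ for every $p\in P$ and every $n\in\mathbb{N}$) and whose partial sums are bounded: there is a constant $C$ such that $\left|\sum_{n\le x} f(n)\right|\le C$ for all $x\ge 1$.
   Context: Here $\mathbb{N}=\{1,2,3,\dots\}$. No multiplicativity is required with respect to primes outside $P$; the values of $f$ at integers coprime to all primes in $P$ may be chosen freely. *)

theory Defs
  imports Complex_Main "HOL-Computational_Algebra.Primes"
begin

definition P_multiplicative :: "nat set \<Rightarrow> (nat \<Rightarrow> int) \<Rightarrow> bool" where
  "P_multiplicative P f \<longleftrightarrow> (\<forall>p\<in>P. \<forall>n\<ge>1. f (p * n) = f p * f n)"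

end

theory Submission
  imports Defs
begin

text \<open>
  Set \<open>f p = 1\<close> on \<open>P\<close>, so that only the values at integers coprime to \<open>Q = \<Prod>P\<close> are free, and
  write the summatory function as \<open>S = H + T\<close> with \<open>H\<close> the sum over free and \<open>T\<close> the sum over
  forced integers; \<open>T\<close> up to \<open>x\<close> is determined by \<open>f\<close> up to \<open>x / 2\<close>. The free values are chosen
  greedily to make \<open>H\<close> follow the piecewise linear function \<open>R\<close> that interpolates \<open>-T\<close> at the
  multiples of a large \<open>L\<close>. As long as the slopes of \<open>R\<close> are at most \<open>1 / Q\<close>, the error \<open>H - R\<close> is
  bounded by \<open>3\<close>, and hence so is \<open>S\<close> at the multiples of \<open>L\<close>.

  Between these points, \<open>S x\<close> is the sum of \<open>H (x / s)\<close> over \<open>s dvd Q ^ a\<close>, up to the contribution of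
  the integers divisible by some \<open>p ^ Suc a\<close>, of density at most \<open>card P / 2 ^ Suc a\<close>. Each
  \<open>R (x / s)\<close> is affine between consecutive multiples of \<open>L\<close>, because its breakpoints are multiples
  of \<open>s * L\<close>. So the drift drops out: \<open>S\<close> deviates from its own linear interpolation only by
  \<open>8\<close> per divisor of \<open>Q ^ a\<close> plus \<open>card P * L / 2 ^ Suc a\<close>, independently of the slopes of \<open>R\<close>.
  Taking first \<open>a\<close> and then \<open>L\<close> large makes this a small multiple of \<open>L\<close>. Inclusion-exclusion bounds
  \<open>T\<close> by \<open>2 ^ card P\<close> times the bound on \<open>S\<close>, so the slopes of \<open>R\<close> stay admissible.
\<close>

section \<open>The greedy recursive construction\<close>

definition unsieved :: "nat set \<Rightarrow> nat \<Rightarrow> bool" where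
  "unsieved P n \<longleftrightarrow> (\<forall>p\<in>P. \<not> p dvd n)"

definition sieving_prime :: "nat set \<Rightarrow> nat \<Rightarrow> nat" where
  "sieving_prime P n = (LEAST p. p \<in> P \<and> p dvd n)"

definition free_sum :: "nat set \<Rightarrow> (nat \<Rightarrow> int) \<Rightarrow> nat \<Rightarrow> real" where
  "free_sum P f x = (\<Sum>n\<in>{n\<in>{1..x}. unsieved P n}. real_of_int (f n))"

text \<open>Summing \<open>f (n div sieving_prime P n)\<close> instead of \<open>f n\<close> makes
  the sum read only values up to \<open>x / 2\<close> for every \<open>f\<close>, as the recursion
  requires.\<close>

definition forced_sum :: "nat set \<Rightarrow> (nat \<Rightarrow> int) \<Rightarrow> nat \<Rightarrow> real" where
  "forced_sum P f x =
     (\<Sum>n\<in>{n\<in>{1..x}. \<not> unsieved P n}. real_of_int (f (n div sieving_prime P n)))"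

text \<open>
  The node at \<open>L\<close> itself is \<open>0\<close>: its target \<open>- T L\<close> would depend on values that are
  only chosen on the way from \<open>0\<close> to \<open>L\<close>.
\<close>
definition node :: "nat set \<Rightarrow> nat \<Rightarrow> (nat \<Rightarrow> int) \<Rightarrow> nat \<Rightarrow> real" where
  "node P L f j = (if j \<le> 1 then 0 else - forced_sum P f (j * L))"

definition target :: "nat set \<Rightarrow> nat \<Rightarrow> (nat \<Rightarrow> int) \<Rightarrow> real \<Rightarrow> real" where
  "target P L f y = (let j = nat \<lfloor>y / real L\<rfloor>
     in node P L f j + (y / real L - real j) * (node P L f (Suc j) - node P L f j))"

definition rule :: "nat set \<Rightarrow> nat \<Rightarrow> (nat \<Rightarrow> int) \<Rightarrow> nat \<Rightarrow> int" where
  "rule P L f n =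
     (if n = 0 then 1
      else if \<not> unsieved P n then f (n div sieving_prime P n)
      else if free_sum P f (n - 1) \<le> target P L f (real (n - 1)) then 1 else - 1)"

lemma sieving_prime:
  assumes "\<not> unsieved P n"
  shows "sieving_prime P n \<in> P" "sieving_prime P n dvd n"
proof -
  have "\<exists>p. p \<in> P \<and> p dvd n" using assms by (auto simp: unsieved_def)
  then have "sieving_prime P n \<in> P \<and> sieving_prime P n dvd n"
    unfolding sieving_prime_def by (rule LeastI_ex)
  then show "sieving_prime P n \<in> P" "sieving_prime P n dvd n" by auto
qed

lemma div_sieving_prime_le:
  assumes "\<forall>p\<in>P. prime p" "\<not> unsieved P n"
  shows "2 * (n div sieving_prime P n) \<le> n"
proof -
  have "sieving_prime P n \<ge> 2"
    using sieving_prime(1)[OF assms(2)] assms(1) prime_ge_2_nat by blast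
  then have "2 * (n div sieving_prime P n) \<le> sieving_prime P n * (n div sieving_prime P n)"
    by (rule mult_le_mono1)
  also have "\<dots> \<le> n" by simp
  finally show ?thesis .
qed

text \<open>Well-founded recursion applies because \<open>rule\<close> reads only smaller arguments.
  This holds even for the node at the right end \<open>Suc j * L\<close> of the current block: for
  \<open>j \<ge> 1\<close> its forced sum reads values up to half of that, hence at most
  \<open>j * L\<close>.\<close>

lemma ex_rule_fixed_point:
  assumes P: "\<forall>p\<in>P. prime p" and L: "L > 0"
  shows "\<exists>f. \<forall>n. f n = rule P L f n"
proof -
  have rule_cong: "rule P L f n = rule P L g n" if fg: "\<And>m. m < n \<Longrightarrow> f m = g m" for f g n
  proof (cases "n = 0")
    case True
    then show ?thesis by (simp add: rule_def)
  next
    case n: False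
    have H: "free_sum P f (n - 1) = free_sum P g (n - 1)"
      unfolding free_sum_def using n by (intro sum.cong) (auto intro!: fg)
    define j where "j = (n - 1) div L"
    have jL: "j * L < n" using n unfolding j_def
      by (metis One_nat_def Suc_pred bot_nat_0.not_eq_extremum div_times_less_eq_dividend less_Suc_eq_le)
    have c: "node P L f i = node P L g i" if "i \<le> Suc j" for i
    proof (cases "i \<le> 1")
      case False
      have "forced_sum P f (i * L) = forced_sum P g (i * L)"
        unfolding forced_sum_def
      proof (intro sum.cong refl)
        fix m assume "m \<in> {m \<in> {1..i * L}. \<not> unsieved P m}"
        then have m: "m \<le> i * L" "\<not> unsieved P m" by auto
        have "2 * (m div sieving_prime P m) \<le> i * L"
          using div_sieving_prime_le[OF P m(2)] m(1) by simp
        also have "\<dots> \<le> (2 * j) * L" using that False by (intro mult_le_mono1) auto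
        finally have "m div sieving_prime P m < n" using jL by simp
        then show "real_of_int (f (m div sieving_prime P m)) = real_of_int (g (m div sieving_prime P m))"
          using fg by simp
      qed
      then show ?thesis by (simp add: node_def)
    qed (simp add: node_def)
    have fl: "nat \<lfloor>real (n - 1) / real L\<rfloor> = j"
      by (simp add: j_def floor_divide_of_nat_eq del: of_nat_diff)
    have R: "target P L f (real (n - 1)) = target P L g (real (n - 1))"
      unfolding target_def fl Let_def using c[of j] c[of "Suc j"] by simp
    have "f (n div sieving_prime P n) = g (n div sieving_prime P n)" if "\<not> unsieved P n"
      using div_sieving_prime_le[OF P that] n by (intro fg) linarith
    then show ?thesis unfolding rule_def H R by auto
  qed
  show ?thesis
  proof (rule dependent_wf_choice[where R = less_than and P = "\<lambda>f n r. r = rule P L f n"])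
    fix f g :: "nat \<Rightarrow> int" and n r
    assume "\<And>m. (m, n) \<in> less_than \<Longrightarrow> f m = g m"
    then have "rule P L f n = rule P L g n" by (intro rule_cong) simp
    then show "(r = rule P L f n) = (r = rule P L g n)" by (rule arg_cong)
  qed (rule wf_less_than, rule exI, rule refl)
qed

lemma abs_convex_le:
  fixes t b d M :: real
  assumes "0 \<le> t" "t \<le> 1" "\<bar>b\<bar> \<le> M" "\<bar>d\<bar> \<le> M"
  shows "\<bar>(1 - t) * b + t * d\<bar> \<le> M"
proof -
  have "\<bar>(1 - t) * b + t * d\<bar> \<le> (1 - t) * \<bar>b\<bar> + t * \<bar>d\<bar>"
    using assms abs_triangle_ineq[of "(1 - t) * b" "t * d"] by (simp add: abs_mult)
  also have "\<dots> \<le> M" using assms by (intro convex_bound_le) auto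
  finally show ?thesis .
qed

section \<open>Values and multiplicativity of the constructed function\<close>

text \<open>The divisibility makes \<open>p ^ Suc a\<close> divide the block length \<open>L\<close>
  for each \<open>p \<in> P\<close>, so its multiples can be counted block by block without
  rounding.\<close>

locale steered =
  fixes P :: "nat set" and L a :: nat and f :: "nat \<Rightarrow> int"
  assumes fin: "finite P" and primes: "\<And>p. p \<in> P \<Longrightarrow> prime p"
    and L_pos: "L > 0" and dvd_L: "(\<Prod>P) ^ Suc a dvd L"
    and f_rule: "\<And>n. f n = rule P L f n"
begin

definition "Q = \<Prod>P"
abbreviation "H \<equiv> free_sum P f"
abbreviation "T \<equiv> forced_sum P f"
abbreviation "c \<equiv> node P L f"
abbreviation "R \<equiv> target P L f"
definition "S x = (\<Sum>n\<in>{1..x}. real_of_int (f n))"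

lemma dvd_Q: "p \<in> P \<Longrightarrow> p dvd Q"
  unfolding Q_def using dvd_prodI[OF fin, of p "\<lambda>x. x"] by simp

lemma Q_pos: "Q > 0"
  unfolding Q_def using primes by (intro prod_pos) (auto intro: prime_gt_0_nat)

lemma f_forced: "f n = f (n div sieving_prime P n)" if "n > 0" "\<not> unsieved P n"
  using f_rule[of n] that by (simp add: rule_def)

lemma f_free: "f n = (if H (n - 1) \<le> R (real (n - 1)) then 1 else - 1)"
  if "n > 0" "unsieved P n"
  using f_rule[of n] that by (simp add: rule_def)

lemma f_values: "n > 0 \<Longrightarrow> f n \<in> {-1, 1}"
proof (induction n rule: less_induct)
  case (less n)
  show ?case
  proof (cases "unsieved P n")
    case False
    let ?m = "n div sieving_prime P n"
    have "2 * ?m \<le> n" using div_sieving_prime_le False primes by blast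
    moreover have "?m > 0" using sieving_prime[OF False] primes less.prems
      by (metis dvd_div_eq_0_iff gr0I neq0_conv)
    ultimately show ?thesis using less.IH[of ?m] f_forced[OF less.prems False] by auto
  qed (use f_free[OF less.prems] in auto)
qed

text \<open>The recursion removes only the least prime \<open>r\<close> of \<open>P\<close> dividing
  \<open>p * n\<close>. If \<open>r \<noteq> p\<close>, then \<open>r\<close> is also the least one
  dividing \<open>n\<close>, and removing it on both sides reduces the claim to
  \<open>n div r\<close>.\<close>

lemma f_mult: "f (p * n) = f n" if "p \<in> P" "n > 0"
  using that
proof (induction n rule: less_induct)
  case (less n)
  have p: "prime p" "p > 0" using primes less.prems by (auto intro: prime_gt_0_nat)
  have ns: "\<not> unsieved P (p * n)" using less.prems unfolding unsieved_def by (meson dvd_triv_left)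
  define r where "r = sieving_prime P (p * n)"
  have r: "r \<in> P" "r dvd p * n" using sieving_prime[OF ns] by (auto simp: r_def)
  have eq: "f (p * n) = f (p * n div r)"
    using f_forced[OF _ ns] less.prems p by (simp add: r_def)
  show ?case
  proof (cases "r = p")
    case True
    then show ?thesis using eq p by simp
  next
    case False
    have "r dvd n" using r False p primes
      by (metis prime_dvd_mult_iff primes_dvd_imp_eq)
    have nsn: "\<not> unsieved P n" using r \<open>r dvd n\<close> by (auto simp: unsieved_def)
    have "sieving_prime P n = r"
      unfolding sieving_prime_def
    proof (rule Least_equality)
      fix y assume "y \<in> P \<and> y dvd n"
      then show "r \<le> y" unfolding r_def sieving_prime_def by (intro Least_le) auto
    qed (use r \<open>r dvd n\<close> in auto)
    then have n: "f n = f (n div r)" using f_forced[OF less.prems(2) nsn] by simp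
    have "r \<ge> 2" using r primes prime_ge_2_nat by blast
    then have "n div r < n" "n div r > 0"
      using less.prems \<open>r dvd n\<close> by (auto simp: dvd_imp_le div_greater_zero_iff)
    then have "f (p * (n div r)) = f (n div r)" using less by blast
    moreover have "p * n div r = p * (n div r)" using \<open>r dvd n\<close> by (rule div_mult_swap[symmetric])
    ultimately show ?thesis using eq n by simp
  qed
qed

lemma unsieved_1: "unsieved P 1"
  using primes by (force simp: unsieved_def)

lemma c_01 [simp]: "c 0 = 0" "c (Suc 0) = 0" by (auto simp: node_def)

lemma f_1: "f 1 = 1"
  using f_free[OF _ unsieved_1] by (simp add: free_sum_def target_def Let_def)

lemma S_eq: "S x = H x + T x"
proof -
  have "S x = (\<Sum>n\<in>{n\<in>{1..x}. unsieved P n} \<union> {n\<in>{1..x}. \<not> unsieved P n}. real_of_int (f n))"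
    unfolding S_def by (intro sum.cong) auto
  also have "\<dots> = H x + (\<Sum>n\<in>{n\<in>{1..x}. \<not> unsieved P n}. real_of_int (f n))"
    unfolding free_sum_def by (intro sum.union_disjoint) auto
  also have "(\<Sum>n\<in>{n\<in>{1..x}. \<not> unsieved P n}. real_of_int (f n)) = T x"
    unfolding forced_sum_def by (intro sum.cong) (auto simp: f_forced[symmetric])
  finally show ?thesis .
qed

section \<open>Inclusion-exclusion over the primes of \<open>P\<close>\<close>

text \<open>The terms lost by also sieving by \<open>p\<close> sit at multiples
  \<open>p * m\<close>, where \<open>f (p * m) = f m\<close>; the primes in \<open>B\<close> do not
  distinguish \<open>m\<close> from \<open>p * m\<close>.\<close>

lemma free_sum_insert:
  assumes "insert p B \<subseteq> P" "p \<notin> B"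
  shows "free_sum (insert p B) f x = free_sum B f x - free_sum B f (x div p)"
proof -
  have p: "prime p" "p > 0" using assms primes prime_gt_0_nat by blast+
  have B: "unsieved B (p * m) \<longleftrightarrow> unsieved B m" for m
    unfolding unsieved_def using assms p primes
    by (metis dvd_mult insert_subset primes_dvd_imp_eq prime_dvd_mult_iff subsetD)
  then have B': "unsieved B (m * p) \<longleftrightarrow> unsieved B m" for m
    by (simp add: mult.commute)
  have split: "{n\<in>{1..x}. unsieved B n} =
      {n\<in>{1..x}. unsieved (insert p B) n} \<union> {n\<in>{1..x}. unsieved B n \<and> p dvd n}"
    by (auto simp: unsieved_def)
  have "free_sum B f x =
      free_sum (insert p B) f x + (\<Sum>n\<in>{n\<in>{1..x}. unsieved B n \<and> p dvd n}. real_of_int (f n))"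
    unfolding free_sum_def split
    by (rule sum.union_disjoint) (auto simp: unsieved_def)
  also have "(\<Sum>n\<in>{n\<in>{1..x}. unsieved B n \<and> p dvd n}. real_of_int (f n)) = free_sum B f (x div p)"
    unfolding free_sum_def
    by (rule sum.reindex_bij_witness[of _ "\<lambda>m. p * m" "\<lambda>n. n div p"])
       (use assms p f_mult[of p] in \<open>auto simp: B B' less_eq_div_iff_mult_less_eq mult.commute dvd_imp_le
          Suc_le_eq elim!: dvdE\<close>)
  finally show ?thesis by simp
qed

text \<open>Each new prime subtracts a sum at \<open>x div p \<le> x / 2\<close> of size at most
  \<open>2 ^ card B * A\<close>, and
  \<open>(2 ^ card B - 1) + 2 ^ card B = 2 ^ Suc (card B) - 1\<close>.\<close>

lemma free_sum_near:
  assumes "B \<subseteq> P" and A: "\<And>y. 2 * y \<le> x \<Longrightarrow> \<bar>S y\<bar> \<le> A"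
  shows "\<bar>free_sum B f x - S x\<bar> \<le> (2 ^ card B - 1) * A"
proof -
  have "finite B" using assms fin finite_subset by blast
  then show ?thesis using assms
  proof (induction B arbitrary: x)
    case empty
    have "{n \<in> {1..x}. unsieved {} n} = {1..x}" by (auto simp: unsieved_def)
    then show ?case by (simp add: free_sum_def S_def del: Collect_mem_eq)
  next
    case (insert p B)
    have p: "p \<ge> 2" using insert.prems primes prime_ge_2_nat by blast
    have px: "2 * (x div p) \<le> x" using p
      by (metis (no_types) div_times_less_eq_dividend mult.commute mult_le_mono2 le_trans)
    have 1: "\<bar>free_sum B f x - S x\<bar> \<le> (2 ^ card B - 1) * A"
      using insert.IH insert.prems by simp
    have "\<bar>free_sum B f (x div p) - S (x div p)\<bar> \<le> (2 ^ card B - 1) * A"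
      using insert.prems px by (intro insert.IH) auto
    moreover have "\<bar>S (x div p)\<bar> \<le> A" using insert.prems px by blast
    ultimately have 2: "\<bar>free_sum B f (x div p)\<bar> \<le> 2 ^ card B * A" by (simp add: algebra_simps)
    have "free_sum (insert p B) f x = free_sum B f x - free_sum B f (x div p)"
      using insert.hyps insert.prems by (intro free_sum_insert) auto
    then have "\<bar>free_sum (insert p B) f x - S x\<bar> \<le> (2 ^ card B - 1) * A + 2 ^ card B * A"
      using 1 2 by linarith
    then show ?case using insert.hyps by (simp add: algebra_simps)
  qed
qed

lemma T_bound:
  assumes A: "\<And>y. 2 * y \<le> x \<Longrightarrow> \<bar>S y\<bar> \<le> A"
  shows "\<bar>T x\<bar> \<le> 2 ^ card P * A"
proof -
  have "A \<ge> 0" using A[of 0] by (simp add: S_def)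
  moreover have "\<bar>H x - S x\<bar> \<le> (2 ^ card P - 1) * A"
    using A by (intro free_sum_near) auto
  ultimately show ?thesis using S_eq[of x] by (simp add: algebra_simps)
qed

subsection \<open>Tracking the interpolant\<close>

text \<open>Adjacent pieces agree at their common node, so the formula extends to the right
  endpoint, where \<open>target\<close> already uses the next piece.\<close>

lemma R_eq:
  assumes "real j * L \<le> y" "y \<le> real (Suc j) * L"
  shows "R y = c j + (y / L - j) * (c (Suc j) - c j)"
proof (cases "y = real (Suc j) * L")
  case True
  then have "y / L = real (Suc j)" using L_pos by simp
  then show ?thesis unfolding target_def by (simp del: of_nat_Suc) simp
next
  case False
  then have "\<lfloor>y / L\<rfloor> = int j" using assms L_pos by (simp add: floor_eq_iff field_simps)
  then show ?thesis by (simp add: target_def)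
qed

lemma R_grid: "R (real (j * L)) = c j"
  using R_eq[of j "real (j * L)"] L_pos by simp

text \<open>The slopes of \<open>R\<close> on the first \<open>j\<close> blocks are at most
  \<open>1 / Q\<close>, with denominators cleared.\<close>

definition gentle :: "nat \<Rightarrow> bool" where
  "gentle j \<longleftrightarrow> (\<forall>i<j. \<bar>c (Suc i) - c i\<bar> * Q \<le> L)"

lemma R_step:
  assumes "gentle j" "n < j * L" "real n \<le> y" "y \<le> real (Suc n)"
  shows "\<bar>R y - R (real n)\<bar> * Q \<le> 1"
proof -
  define i where "i = n div L"
  have "i < j" using assms(2) L_pos by (simp add: i_def less_mult_imp_div_less)
  then have i: "\<bar>c (Suc i) - c i\<bar> * Q \<le> L" using assms(1) by (simp add: gentle_def)
  have "i * L \<le> n" "Suc n \<le> Suc i * L"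
    using L_pos by (simp_all add: i_def dividend_less_div_times Suc_le_eq add.commute)
  then have b: "real i * L \<le> real n" "real (Suc n) \<le> real (Suc i) * L"
    by (metis of_nat_le_iff of_nat_mult)+
  have "R y - R (real n) = (y - n) / L * (c (Suc i) - c i)"
    using R_eq[of i y] R_eq[of i "real n"] b assms L_pos by (simp add: field_simps)
  then have "\<bar>R y - R (real n)\<bar> * Q = (y - n) * (\<bar>c (Suc i) - c i\<bar> * Q / L)"
    using assms by (simp add: abs_mult)
  also have "\<dots> \<le> 1 * 1" using i assms L_pos by (intro mult_mono) auto
  finally show ?thesis by simp
qed

lemma H_Suc: "H (Suc n) = H n + (if unsieved P (Suc n) then real_of_int (f (Suc n)) else 0)"
proof -
  have "{m\<in>{1..Suc n}. unsieved P m} = (if unsieved P (Suc n) then {Suc n} else {}) \<union> {m\<in>{1..n}. unsieved P m}"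
    by (auto simp: le_Suc_eq)
  then show ?thesis by (auto simp: free_sum_def)
qed

lemma unsieved_Suc: "unsieved P (Suc n)" if "Q dvd n"
  unfolding unsieved_def
proof
  fix p assume p: "p \<in> P"
  then have "p dvd n" using that dvd_trans dvd_Q by blast
  then show "\<not> p dvd Suc n" using primes[OF p] not_prime_unit
    by (metis dvd_add_right_iff Suc_eq_plus1)
qed

text \<open>
  The error can grow by at most \<open>1 / Q\<close> per step between two free integers, and every \<open>n\<close>
  congruent to \<open>1\<close> modulo \<open>Q\<close> is free. The remainder below counts the steps since the last such \<open>n\<close>;
  adding \<open>Q - 1\<close> replaces the truncated \<open>n - 1\<close>.
\<close>
lemma tracking_aux:
  assumes "gentle j" "n \<le> j * L"
  shows "\<bar>H n - R (real n)\<bar> * Q \<le> 2 * Q + (Q - 1 + n) mod Q"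
  using assms(2)
proof (induction n)
  case 0
  have "R 0 = 0" using R_grid[of 0] by simp
  then show ?case by (simp add: free_sum_def)
next
  case (Suc n)
  define u v d r where "u = H n - R (real n)" and "v = H (Suc n) - R (real (Suc n))"
    and "d = R (real (Suc n)) - R (real n)" and "r = real ((Q - 1 + n) mod Q)"
  have IH: "\<bar>u\<bar> * Q \<le> 2 * Q + r" using Suc by (simp add: u_def r_def)
  have d: "\<bar>d\<bar> * Q \<le> 1" using R_step[OF assms(1), of n] Suc.prems by (simp add: d_def)
  have v: "v = u + (if unsieved P (Suc n) then (if u \<le> 0 then 1 else -1) else 0) - d"
    using f_free[of "Suc n"] by (simp add: u_def v_def d_def H_Suc)
  have Q1: "real Q \<ge> 1" using Q_pos by linarith
  have "\<bar>d\<bar> * 1 \<le> \<bar>d\<bar> * Q" using Q1 by (intro mult_left_mono) auto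
  then have d1: "\<bar>d\<bar> \<le> 1" using d by linarith
  have goal: "\<bar>v\<bar> * Q \<le> 2 * Q + n mod Q"
  proof (cases "unsieved P (Suc n)")
    case True
    \<comment> \<open>The step of size 1 points towards 0: either it crosses 0, leaving at most
      \<open>1 + \<bar>d\<bar>\<close>, or it shortens \<open>u\<close> by 1.\<close>
    have "\<bar>v\<bar> \<le> 2 \<or> \<bar>v\<bar> \<le> \<bar>u\<bar> - 1 + \<bar>d\<bar>" using d1 v True by (auto split: if_splits)
    then have "\<bar>v\<bar> * Q \<le> 2 * real Q \<or> \<bar>v\<bar> * Q \<le> (\<bar>u\<bar> - 1 + \<bar>d\<bar>) * Q"
      using Q1 by (meson mult_right_mono of_nat_0_le_iff)
    moreover have "(\<bar>u\<bar> - 1 + \<bar>d\<bar>) * Q = \<bar>u\<bar> * Q - Q + \<bar>d\<bar> * Q" by (simp add: algebra_simps)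
    moreover have "r + 1 \<le> Q"
      using mod_less_divisor[OF Q_pos, of "Q - 1 + n"] unfolding r_def by linarith
    ultimately have "\<bar>v\<bar> * Q \<le> 2 * real Q" using IH d by auto
    then show ?thesis by (simp add: add_increasing2)
  next
    case False
    \<comment> \<open>A sieved \<open>Suc n\<close> rules out a wrap-around of the remainder, so the
      allowance grows by exactly 1 and pays for \<open>d\<close>.\<close>
    then have "\<not> Q dvd n" using unsieved_Suc[of n] by argo
    then have "n mod Q \<noteq> 0" using mod_0_imp_dvd[of n Q] by argo
    then obtain k where k: "n mod Q = Suc k" using not0_implies_Suc by blast
    have kQ: "k < Q" using mod_less_divisor[OF Q_pos, of n] k by linarith
    have "(Q - 1 + n) mod Q = (Q - 1 + n mod Q) mod Q" by (rule mod_add_right_eq[symmetric])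
    also have "Q - 1 + n mod Q = k + Q" using k Q_pos by simp
    also have "(k + Q) mod Q = k" using kQ by simp
    finally have "r + 1 = n mod Q" using k by (simp add: r_def)
    moreover have "\<bar>v\<bar> * Q \<le> (\<bar>u\<bar> + \<bar>d\<bar>) * Q" using v False by (intro mult_right_mono) auto
    then have "\<bar>v\<bar> * Q \<le> \<bar>u\<bar> * Q + \<bar>d\<bar> * Q" by (simp only: distrib_right)
    ultimately show ?thesis using IH d by linarith
  qed
  have "(Q - 1 + Suc n) mod Q = n mod Q" using Q_pos by simp
  then show ?case using goal by (simp add: v_def)
qed

lemma tracking:
  assumes "gentle j" "n \<le> j * L"
  shows "\<bar>H n - R (real n)\<bar> \<le> 3"
proof -
  have "(Q - 1 + n) mod Q \<le> Q" using Q_pos by (simp add: less_imp_le)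
  then have "\<bar>H n - R (real n)\<bar> * Q \<le> 3 * Q" using tracking_aux[OF assms] by linarith
  then show ?thesis using Q_pos by simp
qed

subsection \<open>Decomposition by the sieved part\<close>

text \<open>As \<open>Q\<close> is squarefree, a positive \<open>n\<close> is overfull exactly if
  its part composed of primes of \<open>P\<close> does not divide \<open>Q ^ a\<close>.\<close>

definition "overfull n \<longleftrightarrow> (\<exists>p\<in>P. p ^ Suc a dvd n)"

definition "G x = (\<Sum>n\<in>{n\<in>{1..x}. overfull n}. real_of_int (f n))"

definition "D = {s. s dvd Q ^ a}"

text \<open>Bounds the number of overfull integers in a block, as
  \<open>p ^ Suc a \<ge> 2 ^ Suc a\<close>.\<close>

definition "B = real (card P) * real L / 2 ^ Suc a"

lemma finite_D: "finite D"
  unfolding D_def using Q_pos by (intro finite_divisors_nat) simp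

lemma D_pos: "s \<in> D \<Longrightarrow> s > 0"
  unfolding D_def using Q_pos dvd_pos_nat[of "Q ^ a" s] by simp

lemma unsieved_iff_coprime: "unsieved P n \<longleftrightarrow> coprime n Q"
proof
  assume "unsieved P n"
  then have "coprime n p" if "p \<in> P" for p
    using that primes prime_imp_coprime coprime_commute unfolding unsieved_def by blast
  then show "coprime n Q" unfolding Q_def by (intro prod_coprime_right)
next
  assume n: "coprime n Q"
  show "unsieved P n" unfolding unsieved_def
    using n dvd_Q primes coprime_common_divisor not_prime_unit by blast
qed

lemma f_mult_D: "f (s * m) = f m" if "s dvd Q ^ i" "m > 0" for s m i
  using that
proof (induction s rule: less_induct)
  case (less s)
  have s: "s > 0" using less.prems(1) Q_pos dvd_pos_nat[of "Q ^ i" s] by simp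
  show ?case
  proof (cases "s = 1")
    case False
    then obtain p where p: "prime p" "p dvd s" using prime_factor_nat by blast
    have "p dvd Q" using p less.prems by (meson dvd_trans prime_dvd_power)
    then obtain q where "q \<in> P" "p dvd q"
      using p fin unfolding Q_def by (auto simp: prime_dvd_prod_iff)
    then have pP: "p \<in> P" using p primes primes_dvd_imp_eq by blast
    obtain t where t: "s = p * t" using p by blast
    have "t < s" "t > 0" using s t prime_gt_1_nat[OF p(1)] by auto
    moreover have "t dvd Q ^ i" using less.prems t by (meson dvd_mult_right)
    ultimately show ?thesis using less.IH[of t] f_mult[OF pP, of "t * m"] less.prems t
      by (simp add: mult.assoc)
  qed simp
qed

lemma not_overfull:
  assumes "s \<in> D" "unsieved P m"
  shows "\<not> overfull (s * m)"
proof
  assume "overfull (s * m)"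
  then obtain p where p: "p \<in> P" "p ^ Suc a dvd s * m" by (auto simp: overfull_def)
  have "coprime p m" using assms(2) p primes by (auto simp: unsieved_def intro: prime_imp_coprime)
  then have "p ^ Suc a dvd s" using p by (metis coprime_power_left_iff coprime_dvd_mult_left_iff)
  then have "p ^ Suc a dvd Q ^ a" using assms(1) by (auto simp: D_def intro: dvd_trans)
  moreover have Q: "Q = p * \<Prod>(P - {p})" unfolding Q_def using fin p(1) by (rule prod.remove)
  ultimately have "p dvd \<Prod>(P - {p}) ^ a"
    using primes[OF p(1)] by (auto simp: power_mult_distrib mult.commute)
  then have "p dvd \<Prod>(P - {p})" using primes p prime_dvd_power by blast
  then obtain q where "q \<in> P - {p}" "p dvd q"
    using p primes fin by (auto simp: prime_dvd_prod_iff)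
  then show False using p primes primes_dvd_imp_eq by blast
qed

text \<open>If \<open>p\<close> still divided the cofactor, a power \<open>p ^ i\<close> dividing
  the gcd could always be raised by one, up to \<open>p ^ Suc a\<close>.\<close>

lemma unsieved_cofactor:
  assumes "n > 0" "\<not> overfull n"
  shows "unsieved P (n div gcd n (Q ^ a))"
  unfolding unsieved_def
proof safe
  fix p assume p: "p \<in> P" "p dvd n div gcd n (Q ^ a)"
  let ?g = "gcd n (Q ^ a)"
  have "p ^ i dvd ?g" if "i \<le> Suc a" for i
    using that
  proof (induction i)
    case (Suc i)
    have "p * p ^ i dvd (n div ?g) * ?g" using p Suc by (intro mult_dvd_mono) auto
    then have 1: "p ^ Suc i dvd n" by simp
    then have "i \<noteq> a" using assms p by (auto simp: overfull_def)
    then have "p ^ Suc i dvd Q ^ a"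
      using Suc.prems dvd_Q[OF p(1)] dvd_power_le[of p Q "Suc i" a] by simp
    then show ?case using 1 by simp
  qed simp
  then have "p ^ Suc a dvd n" by (meson dvd_trans gcd_dvd1 order_refl)
  then show False using assms p by (auto simp: overfull_def)
qed

text \<open>Each positive \<open>n\<close> that is not overfull factors uniquely as
  \<open>s * m\<close> with \<open>s \<in> D\<close> and \<open>m\<close> coprime to
  \<open>Q\<close>, namely with \<open>s = gcd n (Q ^ a)\<close>, and
  \<open>f n = f m\<close>.\<close>

lemma S_decomp: "S x = (\<Sum>s\<in>D. H (x div s)) + G x"
proof -
  have "S x = (\<Sum>n\<in>{n\<in>{1..x}. \<not> overfull n} \<union> {n\<in>{1..x}. overfull n}. real_of_int (f n))"
    unfolding S_def by (intro sum.cong) auto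
  also have "\<dots> = (\<Sum>n\<in>{n\<in>{1..x}. \<not> overfull n}. real_of_int (f n)) + G x"
    unfolding G_def by (intro sum.union_disjoint) auto
  also have "(\<Sum>n\<in>{n\<in>{1..x}. \<not> overfull n}. real_of_int (f n)) =
      (\<Sum>(s, m)\<in>(SIGMA s:D. {m\<in>{1..x div s}. unsieved P m}). real_of_int (f m))"
  proof (rule sum.reindex_bij_witness[of _ "\<lambda>(s, m). s * m"
        "\<lambda>n. (gcd n (Q ^ a), n div gcd n (Q ^ a))"], goal_cases)
    case (1 n)
    then show ?case by simp
  next
    case (2 n)
    then have n: "n > 0" "n \<le> x" "\<not> overfull n" by auto
    have "gcd n (Q ^ a) \<in> D" by (simp add: D_def)
    moreover have "n div gcd n (Q ^ a) \<ge> 1" using n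
      by (metis One_nat_def Suc_leI dvd_div_eq_0_iff gcd_dvd1 gr0I less_numeral_extra(3))
    ultimately show ?case using unsieved_cofactor n by (auto intro: div_le_mono)
  next
    case (3 b)
    then obtain s m where b: "b = (s, m)" "s \<in> D" "m > 0" "unsieved P m" by auto
    have s: "s > 0" using b D_pos by blast
    have "coprime m (Q ^ a)" using b by (simp add: unsieved_iff_coprime)
    then have "gcd (s * m) (Q ^ a) = gcd s (Q ^ a)"
      by (metis gcd.commute gcd_mult_right_right_cancel coprime_commute)
    also have "\<dots> = s" using b by (simp add: D_def gcd_nat.absorb1)
    finally show ?case using b s by simp
  next
    case (4 b)
    then obtain s m where b: "b = (s, m)" "s \<in> D" "m > 0" "m \<le> x div s" "unsieved P m" by auto
    have s: "s > 0" using b D_pos by blast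
    have "s * m \<le> x" using b s by (simp add: less_eq_div_iff_mult_less_eq mult.commute)
    then show ?case using b s not_overfull by auto
  next
    case (5 n)
    then have n: "n > 0" by auto
    let ?g = "gcd n (Q ^ a)"
    have "n div ?g > 0" using n by (metis dvd_div_eq_0_iff gcd_dvd1 gr0I)
    then have "f (?g * (n div ?g)) = f (n div ?g)" by (intro f_mult_D) auto
    then show ?case by simp
  qed
  also have "\<dots> = (\<Sum>s\<in>D. H (x div s))"
    unfolding free_sum_def using finite_D by (subst sum.Sigma) auto
  finally show ?thesis .
qed

lemma card_multiples_le:
  assumes "d dvd L"
  shows "card {n\<in>{j * L<..Suc j * L}. d dvd n} \<le> L div d"
proof -
  obtain l where l: "L = d * l" using assms by blast
  have "{n\<in>{j * L<..Suc j * L}. d dvd n} \<subseteq> (\<lambda>i. d * i) ` {j * l<..Suc j * l}"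
  proof
    fix n assume n: "n \<in> {n\<in>{j * L<..Suc j * L}. d dvd n}"
    then obtain k where k: "n = d * k" by blast
    then have "d * (j * l) < d * k" "d * k \<le> d * (Suc j * l)"
      using n by (simp_all add: k l algebra_simps)
    then have "k \<in> {j * l<..Suc j * l}" by auto
    then show "n \<in> (\<lambda>i. d * i) ` {j * l<..Suc j * l}" unfolding k by blast
  qed
  then have "card {n\<in>{j * L<..Suc j * L}. d dvd n} \<le> card {j * l<..Suc j * l}"
    by (meson surj_card_le finite_greaterThanAtMost)
  also have "\<dots> = L div d" using l L_pos by auto
  finally show ?thesis .
qed

lemma card_overfull: "card {n\<in>{j * L<..Suc j * L}. overfull n} \<le> B"
proof -
  have "{n\<in>{j * L<..Suc j * L}. overfull n} = (\<Union>p\<in>P. {n\<in>{j * L<..Suc j * L}. p ^ Suc a dvd n})"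
    by (auto simp: overfull_def)
  then have "card {n\<in>{j * L<..Suc j * L}. overfull n}
      \<le> (\<Sum>p\<in>P. card {n\<in>{j * L<..Suc j * L}. p ^ Suc a dvd n})"
    using card_UN_le[OF fin] by simp
  then have "real (card {n\<in>{j * L<..Suc j * L}. overfull n})
      \<le> (\<Sum>p\<in>P. real (card {n\<in>{j * L<..Suc j * L}. p ^ Suc a dvd n}))"
    unfolding of_nat_sum[symmetric] of_nat_le_iff .
  also have "\<dots> \<le> (\<Sum>p\<in>P. L / 2 ^ Suc a)"
  proof (rule sum_mono)
    fix p assume p: "p \<in> P"
    have "p ^ Suc a dvd L" using dvd_L dvd_Q[OF p] unfolding Q_def[symmetric]
      by (meson dvd_power_same dvd_trans)
    then have "real (card {n\<in>{j * L<..Suc j * L}. p ^ Suc a dvd n}) \<le> real (L div p ^ Suc a)"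
      using card_multiples_le of_nat_le_iff by blast
    also have "\<dots> \<le> L / real p ^ Suc a" using of_nat_div_le_of_nat[of L "p ^ Suc a"] by simp
    also have "\<dots> \<le> L / 2 ^ Suc a" using prime_ge_2_nat[OF primes[OF p]]
      by (intro divide_left_mono power_mono mult_pos_pos) auto
    finally show "real (card {n\<in>{j * L<..Suc j * L}. p ^ Suc a dvd n}) \<le> L / 2 ^ Suc a" .
  qed
  finally show ?thesis by (simp add: B_def)
qed

lemma G_diff:
  assumes "j * L \<le> x" "x \<le> y" "y \<le> Suc j * L"
  shows "\<bar>G y - G x\<bar> \<le> B"
proof -
  have "G y = (\<Sum>n\<in>{n\<in>{1..x}. overfull n} \<union> {n\<in>{x<..y}. overfull n}. real_of_int (f n))"
    unfolding G_def using assms by (intro sum.cong) auto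
  also have "\<dots> = G x + (\<Sum>n\<in>{n\<in>{x<..y}. overfull n}. real_of_int (f n))"
    unfolding G_def by (intro sum.union_disjoint) auto
  finally have "\<bar>G y - G x\<bar> = \<bar>\<Sum>n\<in>{n\<in>{x<..y}. overfull n}. real_of_int (f n)\<bar>" by simp
  also have "\<dots> \<le> (\<Sum>n\<in>{n\<in>{x<..y}. overfull n}. \<bar>real_of_int (f n)\<bar>)" by (rule sum_abs)
  also have "\<dots> = (\<Sum>n\<in>{n\<in>{x<..y}. overfull n}. 1)"
  proof (intro sum.cong refl)
    fix n assume "n \<in> {n\<in>{x<..y}. overfull n}"
    then show "\<bar>real_of_int (f n)\<bar> = 1" using f_values[of n] by auto
  qed
  also have "\<dots> = real (card {n\<in>{x<..y}. overfull n})" by simp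
  also have "\<dots> \<le> real (card {n\<in>{j * L<..Suc j * L}. overfull n})"
    unfolding of_nat_le_iff using assms by (intro card_mono) auto
  also have "\<dots> \<le> B" by (rule card_overfull)
  finally show ?thesis .
qed

subsection \<open>Boundedness\<close>

lemma R_dilate_affine:
  fixes x :: real and s :: nat
  assumes "s > 0" "real j * L \<le> x" "x \<le> real (Suc j) * L"
  defines "t \<equiv> x / L - j"
  shows "R (x / s) = (1 - t) * R (real (j * L) / s) + t * R (real (Suc j * L) / s)"
proof -
  \<comment> \<open>Index of the one block of \<open>R\<close> that contains block \<open>j\<close>
    shrunk by \<open>s\<close>.\<close>
  define i where "i = j div s"
  have "i * s \<le> j" by (simp add: i_def)
  moreover have "Suc j \<le> Suc i * s"
    using dividend_less_div_times[OF assms(1), of j] by (simp add: i_def)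
  ultimately have i: "real i * s \<le> real j" "real (Suc j) \<le> real (Suc i) * s"
    by (metis of_nat_le_iff of_nat_mult)+
  have R: "R (y / s) = c i + (y / s / L - i) * (c (Suc i) - c i)"
    if y: "real j * L \<le> y" "y \<le> real (Suc j) * L" for y
  proof (rule R_eq)
    have "real i * s * L \<le> y" "y \<le> real (Suc i) * s * L"
      using mult_right_mono[OF i(1), of L] mult_right_mono[OF i(2), of L] y by simp_all
    then show "real i * L \<le> y / s" "y / s \<le> real (Suc i) * L"
      using assms(1) by (simp_all add: field_simps)
  qed
  have "R (real (j * L) / s) = c i + (real j / s - i) * (c (Suc i) - c i)"
    using R[of "real (j * L)"] L_pos by (simp add: mult.commute)
  moreover have "R (real (Suc j * L) / s) = c i + (real (Suc j) / s - i) * (c (Suc i) - c i)"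
    using R[of "real (Suc j) * L"] L_pos unfolding of_nat_mult
    by (simp add: mult.commute del: of_nat_Suc)
  moreover have "R (x / s) = c i + ((j + t) / s - i) * (c (Suc i) - c i)"
    using R[of x] assms by (simp add: mult.commute)
  moreover have "b + ((j + t) / s - i) * m =
      (1 - t) * (b + (real j / s - i) * m) + t * (b + (real (Suc j) / s - i) * m)" for b m
    using assms(1) by (simp add: field_simps)
  ultimately show ?thesis by presburger
qed

text \<open>The 3 of \<open>tracking\<close> plus 1 for rounding \<open>x / s\<close> down to an
  integer.\<close>

lemma tracking_dilate:
  assumes "gentle j" "x \<le> j * L" "s > 0"
  shows "\<bar>H (x div s) - R (real x / real s)\<bar> \<le> 4"
\<comment> \<open>\<open>R_step\<close> needs \<open>x div s\<close> strictly below
  \<open>j * L\<close>. This can fail only for \<open>s = 1\<close>, where nothing is rounded, or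
  for \<open>x = 0\<close>.\<close>
proof (cases "x = j * L \<and> s = 1")
  case True
  then show ?thesis using tracking[OF assms(1,2)] by simp
next
  case False
  have "x div s < j * L \<or> x = 0"
  proof (cases "s = 1")
    case True
    then show ?thesis using False assms(2) by simp
  next
    case s: False
    show ?thesis
    proof (cases "x = 0")
      case x: False
      have "x div s < x" using s x assms(3) by (intro div_less_dividend) auto
      then show ?thesis using assms(2) by linarith
    qed simp
  qed
  then show ?thesis
  proof
    assume less: "x div s < j * L"
    have "real (x div s) \<le> real x / s" by (rule of_nat_div_le_of_nat)
    moreover have "real x / s \<le> real (Suc (x div s))"
      using dividend_less_div_times[OF assms(3), of x] assms(3)
      by (simp add: field_simps flip: of_nat_mult of_nat_add)
    ultimately have "\<bar>R (real x / s) - R (real (x div s))\<bar> * Q \<le> 1"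
      using less by (intro R_step[OF assms(1)])
    moreover from Q_pos have "\<bar>R (real x / s) - R (real (x div s))\<bar> * 1 \<le> \<bar>R (real x / s) - R (real (x div s))\<bar> * Q"
      by (intro mult_left_mono) auto
    ultimately have "\<bar>R (real x / s) - R (real (x div s))\<bar> \<le> 1" by (simp only: mult_1_right)
    moreover have "\<bar>H (x div s) - R (real (x div s))\<bar> \<le> 3"
      using less by (intro tracking[OF assms(1)]) simp
    ultimately show ?thesis by linarith
  next
    assume "x = 0"
    then show ?thesis using R_grid[of 0] by (simp add: free_sum_def)
  qed
qed

lemma S_interpolate:
  assumes "gentle (Suc j)" "j * L \<le> x" "x \<le> Suc j * L"
    and "\<bar>S (j * L)\<bar> \<le> M" "\<bar>S (Suc j * L)\<bar> \<le> M"
  shows "\<bar>S x\<bar> \<le> M + 8 * card D + B"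
proof -
  define u v where "u = j * L" and "v = Suc j * L"
  define t where "t = real x / L - j"
  have xr: "real j * L \<le> x" "x \<le> real (Suc j) * L"
    using assms(2,3) by (metis of_nat_le_iff of_nat_mult)+
  have t: "0 \<le> t" "t \<le> 1" using xr L_pos by (simp_all add: t_def field_simps)
  define E where "E s y = H (y div s) - R (real y / real s)" for s y
  have E: "\<bar>E s y\<bar> \<le> 4" if "s \<in> D" "y \<le> v" for s y
    unfolding E_def using that D_pos assms(1) by (intro tracking_dilate) (auto simp: v_def)
  have SE: "S y = (\<Sum>s\<in>D. E s y) + (\<Sum>s\<in>D. R (real y / s)) + G y" for y
    by (simp add: S_decomp E_def sum_subtractf)
  have "(\<Sum>s\<in>D. R (real x / s)) = (\<Sum>s\<in>D. (1 - t) * R (real u / s) + t * R (real v / s))"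
    unfolding t_def u_def v_def using D_pos xr by (intro sum.cong refl R_dilate_affine) auto
  then have Raff: "(\<Sum>s\<in>D. R (real x / s)) =
      (1 - t) * (\<Sum>s\<in>D. R (real u / s)) + t * (\<Sum>s\<in>D. R (real v / s))"
    by (simp add: sum.distrib sum_distrib_left)
  have Ebd: "\<bar>\<Sum>s\<in>D. E s y\<bar> \<le> 4 * card D" if "y \<le> v" for y
  proof -
    have "\<bar>\<Sum>s\<in>D. E s y\<bar> \<le> (\<Sum>s\<in>D. \<bar>E s y\<bar>)" by (rule sum_abs)
    also have "\<dots> \<le> (\<Sum>s\<in>D. 4)" using that E by (intro sum_mono)
    finally show ?thesis by simp
  qed
  have uv: "u \<le> v" by (simp add: u_def v_def)
  \<comment> \<open>The affine sums over \<open>R\<close> cancel. What remains is the interpolated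
    \<open>S\<close>, two groups of tracking errors of at most 4 per divisor, and increments of
    \<open>G\<close>.\<close>
  have S: "S x = ((1 - t) * S u + t * S v) + (\<Sum>s\<in>D. E s x)
      - ((1 - t) * (\<Sum>s\<in>D. E s u) + t * (\<Sum>s\<in>D. E s v))
      + ((1 - t) * (G x - G u) + t * (G x - G v))"
    unfolding SE[of x] SE[of u] SE[of v] Raff by (simp add: algebra_simps)
  have "\<bar>(1 - t) * S u + t * S v\<bar> \<le> M"
    using assms(4,5) t by (intro abs_convex_le) (auto simp: u_def v_def)
  moreover have "\<bar>\<Sum>s\<in>D. E s x\<bar> \<le> 4 * card D" using Ebd assms(3) by (simp add: v_def)
  moreover have "\<bar>(1 - t) * (\<Sum>s\<in>D. E s u) + t * (\<Sum>s\<in>D. E s v)\<bar> \<le> 4 * card D"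
    using t Ebd uv by (intro abs_convex_le) auto
  moreover have "\<bar>(1 - t) * (G x - G u) + t * (G x - G v)\<bar> \<le> B"
    using t G_diff[of j u x] G_diff[of j x v] assms(2,3)
    by (intro abs_convex_le) (auto simp: u_def v_def abs_minus_commute)
  ultimately show ?thesis using S by linarith
qed

lemma gentle_1: "gentle 1"
  by (simp add: gentle_def)

text \<open>On the first block \<open>R\<close> vanishes, so the decomposition alone bounds
  \<open>S\<close>. This also covers the grid point \<open>L\<close>, whose node is not set to
  \<open>- T L\<close>.\<close>

lemma S_initial:
  assumes "x \<le> L"
  shows "\<bar>S x\<bar> \<le> 3 * card D + B"
proof -
  have H: "\<bar>H y\<bar> \<le> 3" if "y \<le> L" for y
  proof -
    have "real y \<le> real L" using that by simp
    then have "R (real y) = 0" using R_eq[of 0 "real y"] by simp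
    then show ?thesis using tracking[OF gentle_1, of y] that by simp
  qed
  have "\<bar>\<Sum>s\<in>D. H (x div s)\<bar> \<le> (\<Sum>s\<in>D. \<bar>H (x div s)\<bar>)" by (rule sum_abs)
  also have "\<dots> \<le> (\<Sum>s\<in>D. 3)" using assms
    by (intro sum_mono H) (meson div_le_dividend le_trans)
  finally have "\<bar>\<Sum>s\<in>D. H (x div s)\<bar> \<le> 3 * card D" by simp
  moreover have "\<bar>G x - G 0\<bar> \<le> B" using assms by (intro G_diff[of 0]) auto
  moreover have "G 0 = 0" by (simp add: G_def)
  ultimately show ?thesis unfolding S_decomp by linarith
qed

text \<open>From \<open>j = 2\<close> on the node is \<open>- T (j * L)\<close>, so
  \<open>S = H + T = H - R\<close> there.\<close>

lemma S_grid:
  assumes "gentle j"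
  shows "\<bar>S (j * L)\<bar> \<le> 3 * card D + B + 3"
proof (cases "j \<le> 1")
  case True
  then have "j * L \<le> L" by (cases j) auto
  then show ?thesis using S_initial[of "j * L"] by simp
next
  case False
  have "B \<ge> 0" by (simp add: B_def)
  moreover have "\<bar>H (j * L) - R (real (j * L))\<bar> \<le> 3" by (intro tracking[OF assms]) simp
  moreover have "R (real (j * L)) = - T (j * L)" using False R_grid[of j] by (simp add: node_def)
  ultimately show ?thesis using S_eq[of "j * L"] by simp
qed

text \<open>The bound \<open>3 * card D + B + 3\<close> of \<open>S_grid\<close> plus the loss
  \<open>8 * card D + B\<close> of \<open>S_interpolate\<close>.\<close>

definition "A = 11 * real (card D) + 2 * B + 3"

lemma S_bound_upto:
  assumes "gentle j" "x \<le> j * L"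
  shows "\<bar>S x\<bar> \<le> A"
  using assms
proof (induction j)
  case 0
  then show ?case by (simp add: S_def A_def B_def)
next
  case (Suc j)
  have g: "gentle j" using Suc.prems by (simp add: gentle_def)
  show ?case
  proof (cases "x \<le> j * L")
    case True
    then show ?thesis using Suc.IH g by blast
  next
    case False
    then have "\<bar>S x\<bar> \<le> (3 * card D + B + 3) + 8 * card D + B"
      using Suc.prems S_grid[OF g] S_grid[OF Suc.prems(1)] by (intro S_interpolate) simp_all
    then show ?thesis by (simp add: A_def)
  qed
qed

text \<open>Bootstrap: admissible slopes on the first \<open>j\<close> blocks give
  \<open>\<bar>S\<bar> \<le> A\<close> up to \<open>j * L\<close>. By halving, this controls
  \<open>T\<close> up to \<open>2 * j * L\<close>, hence the next slope; for \<open>j = 0\<close>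
  both nodes are 0.\<close>

lemma gentle:
  assumes big: "2 ^ Suc (card P) * real Q * A \<le> L"
  shows "gentle j"
proof (induction j)
  case 0
  then show ?case by (simp add: gentle_def)
next
  case (Suc j)
  have "\<bar>c (Suc j) - c j\<bar> * Q \<le> L"
  proof (cases "j = 0")
    case False
    have "\<bar>c i\<bar> \<le> 2 ^ card P * A" if "i \<le> Suc j" for i
    proof -
      have "\<bar>T (i * L)\<bar> \<le> 2 ^ card P * A"
      proof (rule T_bound)
        fix y assume "2 * y \<le> i * L"
        also have "i * L \<le> (2 * j) * L" using that False by (intro mult_le_mono1) auto
        finally have "y \<le> j * L" by simp
        then show "\<bar>S y\<bar> \<le> A" by (rule S_bound_upto[OF Suc.IH])
      qed
      moreover have "0 \<le> 2 ^ card P * A" by (simp add: A_def B_def)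
      ultimately show ?thesis by (simp add: node_def)
    qed
    from this[of j] this[of "Suc j"] have "\<bar>c (Suc j) - c j\<bar> \<le> 2 ^ Suc (card P) * A" by simp
    then have "\<bar>c (Suc j) - c j\<bar> * Q \<le> 2 ^ Suc (card P) * A * Q" by (intro mult_right_mono) auto
    then show ?thesis using big by (simp add: mult_ac)
  qed simp
  then show ?case using Suc.IH by (auto simp: gentle_def less_Suc_eq)
qed

lemma S_bound:
  assumes "2 ^ Suc (card P) * real Q * A \<le> L"
  shows "\<bar>S x\<bar> \<le> A"
proof (rule S_bound_upto[OF gentle[OF assms], of x x])
  show "x \<le> x * L" using L_pos by simp
qed

end

section \<open>Choice of the parameters\<close>

theorem theorem1:
  fixes P :: "nat set"
  assumes "finite P" and "\<forall>p\<in>P. prime p"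
  shows "\<exists>f :: nat \<Rightarrow> int.
           (\<forall>n\<ge>1. f n \<in> {-1, 1}) \<and> P_multiplicative P f \<and>
           (\<exists>C::real. \<forall>x::real. x \<ge> 1 \<longrightarrow>
              \<bar>\<Sum>n\<in>{n::nat. 1 \<le> n \<and> real n \<le> x}. real_of_int (f n)\<bar> \<le> C)"
proof -
  define k q where "k = card P" and "q = \<Prod>P"
  \<comment> \<open>By \<open>n < 2 ^ n\<close>, this \<open>a\<close> makes the share of
    \<open>2 * B\<close> in the hypothesis of \<open>S_bound\<close> at most
    \<open>L / 2\<close>.\<close>
  define a where "a = q * 2 ^ (k + 2) * k"
  define d where "d = card {s. s dvd q ^ a}"
  \<comment> \<open>\<open>d\<close> depends on \<open>a\<close> but not on \<open>L\<close>, so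
    \<open>L\<close> can be chosen after it; \<open>Z \<le> L\<close> fits the share of
    \<open>11 * d + 3\<close> into the other half of \<open>L\<close>.\<close>
  define Z where "Z = q * 2 ^ (k + 2) * (11 * d + 3)"
  define L where "L = q ^ Suc a * Z"
  have q: "q > 0" unfolding q_def using assms(2) by (intro prod_pos) (auto intro: prime_gt_0_nat)
  have L: "L > 0" using q by (simp add: L_def Z_def)
  obtain f where f: "\<And>n. f n = rule P L f n" using ex_rule_fixed_point[OF assms(2) L] by blast
  interpret steered P L a f
    using assms L f by unfold_locales (auto simp: L_def q_def)
  have "q * 2 ^ (k + 2) * k \<le> 2 ^ a" unfolding a_def by (simp add: less_imp_le)
  then have "real (q * 2 ^ (k + 2) * k) \<le> real (2 ^ a)" unfolding of_nat_le_iff .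
  then have "real q * 2 ^ (k + 2) * k / 2 ^ a * L \<le> 1 * real L"
    by (intro mult_right_mono) simp_all
  then have 1: "2 ^ Suc k * real q * (2 * B) * 2 \<le> L"
    by (simp add: B_def k_def[symmetric] mult_ac)
  have "Z \<le> L" using q by (simp add: L_def)
  then have "real (q * 2 ^ (k + 2) * (11 * d + 3)) \<le> L" unfolding Z_def of_nat_le_iff .
  then have 2: "2 ^ Suc k * real q * (11 * d + 3) * 2 \<le> L" by (simp add: mult_ac)
  have Q: "Q = q" by (simp add: Q_def q_def)
  have "A = (11 * d + 3) + 2 * B" by (simp add: A_def D_def d_def Q)
  then have "2 ^ Suc (card P) * real Q * A * 2 \<le> 2 * L"
    using add_mono[OF 1 2] by (simp add: Q k_def algebra_simps)
  then have S: "\<bar>S x\<bar> \<le> A" for x by (intro S_bound) (simp add: mult_ac)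
  show ?thesis
  proof (intro exI[of _ f] conjI exI[of _ A] allI impI)
    show "f n \<in> {-1, 1}" if "n \<ge> 1" for n using f_values[of n] that by simp
    \<comment> \<open>\<open>f p = f (p * 1) = f 1 = 1\<close> for \<open>p \<in> P\<close>.\<close>
    show "P_multiplicative P f"
      unfolding P_multiplicative_def using f_mult f_mult[of _ 1] f_1 by simp
    fix x :: real assume "x \<ge> 1"
    have "{n::nat. 1 \<le> n \<and> real n \<le> x} = {1..nat \<lfloor>x\<rfloor>}"
      using \<open>x \<ge> 1\<close> by (auto simp: le_nat_floor) linarith
    then show "\<bar>\<Sum>n\<in>{n::nat. 1 \<le> n \<and> real n \<le> x}. real_of_int (f n)\<bar> \<le> A"
      using S[of "nat \<lfloor>x\<rfloor>"] by (simp add: S_def)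
  qed
qed

end
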